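(* Let $\{X_n\}_{n\ge 0}$ be the discrete-time Markov chain on $\mathbb{N}_0=\{0,1,2,\dots\}$ with $X_0=0$ and transition probabilities $$P(X_{n+1}=k+1\mid X_n=k)=\frac{1}{1+k}=1-P(X_{n+1}=k\mid X_n=k),\qquad k\ge 0,$$ and put $p_{n,k}=P(X_n=k)$. Then $$\begin{cases} p_{n+1,k}=\dfrac{k}{k+1}\,p_{n,k}+\dfrac{1}{k}\,p_{n,k-1}, & \forall n\ge 0,\ 1\le k\le n+1,\\[4pt] p_{i,j}=0, & i\ge 0,\ j\ge i+1,\\[2pt] p_{0,0}=1,\quad p_{n,0}=0, & n\ge 1.\end{cases}$$ Furthermore, for all $n\ge k\ge 1$, $$p_{n,k}=\frac{1}{k!}\sum_{i=1}^{k}(-1)^{k-i}\binom{k+1}{i+1}\,i^{k}\left(\frac{i}{i+1}\right)^{n-k}.$$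
   Context: The chain $\{X_n\}$ is the subordinated chain of the pure birth process $\{X(t)\}_{t\ge0}$ on $\mathbb{N}_0$ started at $0$ with birth rates $\lambda_k=\lambda/(1+k)$, where $\lambda=1$: it records the state of the process after $n$ events of the underlying rate-$\lambda$ Poisson process, each event in state $k$ producing a jump to $k+1$ with probability $1/(1+k)$ and no change otherwise. *)

theory Defs
  imports "HOL-Probability.Probability"
begin

text \<open>
  In this library a conditional probability given a null event is \<open>0\<close>. The Markov property is
  therefore only required for histories of positive probability.
\<close>

definition markov_chain :: "'a measure \<Rightarrow> (nat \<Rightarrow> 'a \<Rightarrow> 's::countable) \<Rightarrow> bool" where
  "markov_chain M X \<longleftrightarrow>
     prob_space M \<and>
     (\<forall>n. X n \<in> measurable M (count_space UNIV)) \<and>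
     (\<forall>n x y. \<P>(\<omega> in M. \<forall>i\<le>n. X i \<omega> = x i) > 0 \<longrightarrow>
        \<P>(\<omega> in M. X (Suc n) \<omega> = y \<bar> \<forall>i\<le>n. X i \<omega> = x i) =
        \<P>(\<omega> in M. X (Suc n) \<omega> = y \<bar> X n \<omega> = x n))"

end

theory Submission
  imports Defs
begin

text \<open>
  One step of the chain almost surely increases the state by \<open>0\<close> or \<open>1\<close>, because the two prescribed
  probabilities add up to \<open>1\<close>; conditioning on the previous state gives the recurrence. The claimed
  closed form satisfies the same recurrence for \<open>n \<ge> k\<close>, where its \<open>i = k\<close> summand is
  annihilated by the homogeneous part. On the diagonal \<open>n = k\<close> the recurrence gives \<open>1 / k!\<close>, and the
  closed form gives the same because the \<open>(k+1)\<close>-st finite difference of \<open>(x - 1)\<^sup>k\<close> vanishes.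
\<close>

text \<open>Up to sign this is an \<open>n\<close>-th finite difference of a polynomial of degree
  \<open>m < n\<close>. Splitting one factor \<open>real j + x\<close> and absorbing
  \<open>j\<close> into the binomial coefficient lowers both \<open>m\<close> and \<open>n\<close>
  and shifts \<open>x\<close> to \<open>x + 1\<close>, so the induction leaves \<open>n\<close> and
  \<open>x\<close> free.\<close>

lemma alternating_binomial_sum_power_eq_0:
  fixes x :: real
  assumes "m < n"
  shows "(\<Sum>j\<le>n. (-1) ^ j * real (n choose j) * (real j + x) ^ m) = 0"
  using assms
proof (induction m arbitrary: n x)
  case 0
  then show ?case
    using choose_alternating_sum[of n, where 'a = real] by simp
next
  case (Suc m)
  then obtain n' where n: "n = Suc n'" and less: "m < n'"
    by (cases n) auto
  have absorb: "real (Suc n' choose Suc j) * (1 + real j) = (1 + real n') * real (n' choose j)" for j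
    using Suc_times_binomial_eq[of n' j] by (metis mult.commute of_nat_Suc of_nat_mult)
  have "(\<Sum>j\<le>n. (-1) ^ j * real (n choose j) * (real j * (real j + x) ^ m)) =
      (\<Sum>j\<le>n'. (-1) ^ Suc j * real (Suc n' choose Suc j) * (real (Suc j) * (real (Suc j) + x) ^ m))"
    \<comment> \<open>The factor \<open>real j\<close> kills the term \<open>j = 0\<close>, so only
      the shifted sum remains.\<close>
    unfolding n by (subst sum.atMost_Suc_shift) simp
  also have "\<dots> = (\<Sum>j\<le>n'. - (1 + real n') *
      ((-1) ^ j * real (n' choose j) * (real j + (x + 1)) ^ m))"
  proof (rule sum.cong[OF refl])
    fix j
    have "(-1) ^ Suc j * real (Suc n' choose Suc j) * (real (Suc j) * (real (Suc j) + x) ^ m) =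
        - ((-1) ^ j * (real (Suc n' choose Suc j) * (1 + real j)) * (real j + (x + 1)) ^ m)"
      by (simp add: add_ac mult_ac del: binomial_Suc_Suc)
    also have "\<dots> = - (1 + real n') * ((-1) ^ j * real (n' choose j) * (real j + (x + 1)) ^ m)"
      unfolding absorb by (simp only: mult_ac minus_mult_left[symmetric] minus_mult_right[symmetric])
    finally show "(-1) ^ Suc j * real (Suc n' choose Suc j) * (real (Suc j) * (real (Suc j) + x) ^ m) =
        - (1 + real n') * ((-1) ^ j * real (n' choose j) * (real j + (x + 1)) ^ m)" .
  qed
  also have "\<dots> = 0"
    unfolding sum_distrib_left[symmetric] Suc.IH[OF less] by simp
  finally have first: "(\<Sum>j\<le>n. (-1) ^ j * real (n choose j) * (real j * (real j + x) ^ m)) = 0" .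
  have "(\<Sum>j\<le>n. (-1) ^ j * real (n choose j) * (real j + x) ^ Suc m) =
      (\<Sum>j\<le>n. (-1) ^ j * real (n choose j) * (real j * (real j + x) ^ m)) +
      x * (\<Sum>j\<le>n. (-1) ^ j * real (n choose j) * (real j + x) ^ m)"
    unfolding sum_distrib_left sum.distrib[symmetric]
    by (rule sum.cong[OF refl]) (simp add: algebra_simps)
  then show ?case
    using first Suc.IH[of n x] Suc.prems by simp
qed

text \<open>With \<open>x = -1\<close> and \<open>j = i + 1\<close> the power
  \<open>(j - 1) ^ k\<close> becomes \<open>i ^ k\<close>. The term \<open>j = 0\<close>, equal to
  \<open>(-1) ^ k\<close>, is the one that survives on the other side.\<close>

lemma alternating_binomial_sum_diagonal:
  assumes "k \<ge> 1"
  shows "(\<Sum>i=1..k. (-1) ^ (k - i) * real ((k + 1) choose (i + 1)) * real i ^ k) = 1"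
proof -
  let ?f = "\<lambda>j. (-1) ^ j * real (Suc k choose j) * (real j + (-1)) ^ k"
  have sign: "(-1) ^ (k - i) = (-1 :: real) ^ k * (-1) ^ i" if "i \<le> k" for i
    using that by (auto simp: minus_one_power_iff)
  have "0 = (\<Sum>j\<le>Suc k. ?f j)"
    using alternating_binomial_sum_power_eq_0[of k "Suc k" "-1"] by simp
  also have "\<dots> = ?f 0 + (\<Sum>j\<le>k. ?f (Suc j))"
    by (rule sum.atMost_Suc_shift)
  \<comment> \<open>The dropped summand contains \<open>0 ^ k\<close>, which is zero because
    \<open>k \<ge> 1\<close>.\<close>
  also have "(\<Sum>j\<le>k. ?f (Suc j)) = (\<Sum>j=1..k. ?f (Suc j))"
    using assms by (intro sum.mono_neutral_right) (auto simp: Suc_le_eq power_0_left)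
  also have "\<dots> = - (\<Sum>i=1..k. (-1) ^ i * real ((k + 1) choose (i + 1)) * real i ^ k)"
    unfolding sum_negf[symmetric] by (rule sum.cong) (simp_all del: binomial_Suc_Suc)
  finally have "(\<Sum>i=1..k. (-1) ^ i * real ((k + 1) choose (i + 1)) * real i ^ k) = (-1) ^ k"
    by simp
  then have "(-1) ^ k * (\<Sum>i=1..k. (-1) ^ i * real ((k + 1) choose (i + 1)) * real i ^ k) = 1"
    by (simp flip: power_add)
  moreover have "(\<Sum>i=1..k. (-1) ^ (k - i) * real ((k + 1) choose (i + 1)) * real i ^ k) =
      (-1) ^ k * (\<Sum>i=1..k. (-1) ^ i * real ((k + 1) choose (i + 1)) * real i ^ k)"
    unfolding sum_distrib_left by (rule sum.cong) (simp_all add: sign mult.assoc)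
  ultimately show ?thesis by simp
qed

text \<open>For \<open>k = 0\<close> the sum is empty and the value is 0; this matches the chain for
  \<open>n \<ge> 1\<close> but not at \<open>n = 0\<close>.\<close>

definition birth_closed_form :: "nat \<Rightarrow> nat \<Rightarrow> real" where
  "birth_closed_form n k = 1 / fact k *
     (\<Sum>i=1..k. (-1) ^ (k - i) * real ((k + 1) choose (i + 1)) * real i ^ k
                * (real i / (real i + 1)) ^ (n - k))"

lemma birth_closed_form_diagonal:
  "k \<ge> 1 \<Longrightarrow> birth_closed_form k k = 1 / fact k"
  using alternating_binomial_sum_diagonal[of k] by (simp add: birth_closed_form_def)

text \<open>The recurrence holds summand by summand. The bound on \<open>n\<close> keeps every
  exponent free of truncated subtraction, so the diagonal has to be treated separately.\<close>

lemma birth_closed_form_recurrence: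
  assumes "n \<ge> Suc k"
  shows "birth_closed_form (Suc n) (Suc k) =
    real (Suc k) / (real (Suc k) + 1) * birth_closed_form n (Suc k) +
    1 / real (Suc k) * birth_closed_form n k"
proof -
  define d where "d = n - Suc k"
  have d: "n - Suc k = d" "Suc n - Suc k = Suc d" "n - k = Suc d"
    using assms by (auto simp: d_def)
  let ?r = "\<lambda>i. real i / (real i + 1)"
  let ?c = "\<lambda>k i. (-1) ^ (k - i) * real ((k + 1) choose (i + 1)) * real i ^ k"
  have term_eq: "?c (Suc k) i * ?r i ^ Suc d =
      ?r (Suc k) * (?c (Suc k) i * ?r i ^ d) + ?c k i * ?r i ^ Suc d"
    if i: "i \<in> {1..k}" for i
  proof -
    have B: "real (Suc (Suc k) choose Suc i) * (real k + 1 - real i) =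
        (real k + 2) * real (Suc k choose Suc i)"
    proof -
      have "(Suc (Suc k) - Suc i) * (Suc (Suc k) choose Suc i) = Suc (Suc k) * (Suc k choose Suc i)"
        using binomial_absorb_comp[of "Suc (Suc k)" "Suc i"] by simp
      then have "real (Suc (Suc k) - Suc i) * real (Suc (Suc k) choose Suc i) =
          real (Suc (Suc k)) * real (Suc k choose Suc i)"
        by (metis of_nat_mult)
      moreover have "real (Suc (Suc k) - Suc i) = real k + 1 - real i"
        using i by (simp add: of_nat_diff)
      ultimately show ?thesis by (simp add: mult_ac add_ac del: binomial_Suc_Suc)
    qed
    have s: "(-1) ^ (Suc k - i) = - ((-1 :: real) ^ (k - i))"
      using i by (simp add: Suc_diff_le)
    define b where "b = real (Suc (Suc k) choose Suc i)"
    define b' where "b' = real (Suc k choose Suc i)"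
    have b': "b' = b * (real k + 1 - real i) / (real k + 2)"
      using B by (simp add: b_def b'_def field_simps)
    \<comment> \<open>Here \<open>?r i - ?r (Suc k) = (i - (k + 1)) / ((i + 1) * (k + 2))\<close>,
      and the numerator is exactly the factor, up to sign, that turns \<open>b\<close> into
      \<open>b'\<close>.\<close>
    have "- b * real i ^ Suc k * (?r i - ?r (Suc k)) = b' * real i ^ k * ?r i"
      unfolding b' by (simp add: divide_simps) (simp add: algebra_simps)
    then have "(-1) ^ (k - i) * ?r i ^ d * (- b * real i ^ Suc k * (?r i - ?r (Suc k))) =
        (-1) ^ (k - i) * ?r i ^ d * (b' * real i ^ k * ?r i)"
      by (rule arg_cong)
    then have "- ((-1) ^ (k - i)) * b * real i ^ Suc k * ?r i ^ Suc d =
        ?r (Suc k) * (- ((-1) ^ (k - i)) * b * real i ^ Suc k * ?r i ^ d) +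
        (-1) ^ (k - i) * b' * real i ^ k * ?r i ^ Suc d"
      unfolding power_Suc[of "?r i"] by (simp only: algebra_simps)
    then show ?thesis
      by (simp add: s b_def b'_def del: binomial_Suc_Suc of_nat_Suc power_Suc)
  qed
  have split: "(\<Sum>i=1..Suc k. f i) = (\<Sum>i=1..k. f i) + f (Suc k)" for f :: "nat \<Rightarrow> real"
    by simp
  \<comment> \<open>The summand \<open>i = Suc k\<close> has no partner in column \<open>k\<close>;
    its ratio \<open>?r (Suc k)\<close> is already the coefficient of the homogeneous part.\<close>
  have "(\<Sum>i=1..Suc k. ?c (Suc k) i * ?r i ^ Suc d) =
      ?r (Suc k) * (\<Sum>i=1..Suc k. ?c (Suc k) i * ?r i ^ d) + (\<Sum>i=1..k. ?c k i * ?r i ^ Suc d)"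
  proof -
    have "(\<Sum>i=1..k. ?c (Suc k) i * ?r i ^ Suc d) =
        ?r (Suc k) * (\<Sum>i=1..k. ?c (Suc k) i * ?r i ^ d) + (\<Sum>i=1..k. ?c k i * ?r i ^ Suc d)"
      unfolding sum_distrib_left sum.distrib[symmetric]
      by (rule sum.cong[OF refl]) (rule term_eq)
    then show ?thesis
      unfolding split distrib_left by simp
  qed
  then have "1 / fact (Suc k) * (\<Sum>i=1..Suc k. ?c (Suc k) i * ?r i ^ Suc d) =
      ?r (Suc k) * (1 / fact (Suc k) * (\<Sum>i=1..Suc k. ?c (Suc k) i * ?r i ^ d)) +
      1 / real (Suc k) * (1 / fact k * (\<Sum>i=1..k. ?c k i * ?r i ^ Suc d))"
    by (simp only: fact_Suc of_nat_mult) (simp add: distrib_left mult_ac)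
  then show ?thesis
    unfolding birth_closed_form_def d .
qed

lemma birth_recurrence_unique:
  fixes p :: "nat \<Rightarrow> nat \<Rightarrow> real"
  assumes rec: "\<And>n k. p (Suc n) (Suc k) =
      real (Suc k) / (real (Suc k) + 1) * p n (Suc k) + 1 / real (Suc k) * p n k"
    and above: "\<And>n k. n < k \<Longrightarrow> p n k = 0"
    and p00: "p 0 0 = 1"
    and p0: "\<And>n. n \<ge> 1 \<Longrightarrow> p n 0 = 0"
    and "n \<ge> k" "k \<ge> 1"
  shows "p n k = birth_closed_form n k"
proof -
  \<comment> \<open>The homogeneous term vanishes by \<open>above\<close>, leaving division by
    \<open>Suc k\<close> at each step.\<close>
  have diagonal: "p k k = 1 / fact k" for k
    by (induction k) (simp_all add: p00 rec above)
  have "p n (Suc k) = birth_closed_form n (Suc k)" if "n \<ge> Suc k" for n k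
    using that
  proof (induction n arbitrary: k)
    case (Suc n)
    show ?case
    proof (cases "n = k")
      case True
      then show ?thesis
        using diagonal[of "Suc k"] birth_closed_form_diagonal[of "Suc k"] by simp
    next
      case False
      with Suc.prems have le: "n \<ge> Suc k" by simp
      \<comment> \<open>Column 0 lies outside the induction hypothesis; there both sides are 0,
        since \<open>le\<close> gives \<open>n \<ge> 1\<close>.\<close>
      have "p n k = birth_closed_form n k"
      proof (cases k)
        case 0
        then show ?thesis using p0[of n] le by (simp add: birth_closed_form_def)
      next
        case (Suc k')
        then show ?thesis using Suc.IH[of k'] le by simp
      qed
      then show ?thesis
        using rec[of n k] birth_closed_form_recurrence[OF le] Suc.IH[OF le] by simp
    qed
  qed simp
  from this[of "k - 1" n] show ?thesis using assms(5,6) by simp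
qed

text \<open>Turns a conditional probability known only for a non-null condition into an
  unconditional product formula: if \<open>Q\<close> is null, both sides are 0.\<close>

lemma (in prob_space) prob_conj_eq_cond_prob_mult:
  assumes [measurable]: "{\<omega> \<in> space M. P \<omega>} \<in> events" "{\<omega> \<in> space M. Q \<omega>} \<in> events"
    and "\<P>(\<omega> in M. Q \<omega>) > 0 \<Longrightarrow> \<P>(\<omega> in M. P \<omega> \<bar> Q \<omega>) = c"
  shows "\<P>(\<omega> in M. P \<omega> \<and> Q \<omega>) = c * \<P>(\<omega> in M. Q \<omega>)"
proof (cases "\<P>(\<omega> in M. Q \<omega>) = 0")
  case True
  have "\<P>(\<omega> in M. P \<omega> \<and> Q \<omega>) \<le> \<P>(\<omega> in M. Q \<omega>)"
    using assms(2) by (intro finite_measure_mono) auto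
  then show ?thesis
    using True measure_nonneg[of M "{\<omega> \<in> space M. P \<omega> \<and> Q \<omega>}"] by simp
next
  case False
  then have "\<P>(\<omega> in M. Q \<omega>) > 0"
    using measure_nonneg[of M "{\<omega> \<in> space M. Q \<omega>}"] by linarith
  then show ?thesis
    using assms(3) by (auto simp: cond_prob_def field_simps)
qed

text \<open>A single transition, from \<open>Y\<close> in the role of \<open>X n\<close> to
  \<open>Z\<close> in the role of \<open>X (Suc n)\<close>.\<close>

locale birth_step = prob_space M for M :: "'a measure" +
  fixes Y Z :: "'a \<Rightarrow> nat"
  assumes measurable_Y [measurable]: "Y \<in> measurable M (count_space UNIV)"
    and measurable_Z [measurable]: "Z \<in> measurable M (count_space UNIV)"
    and up: "\<And>k. \<P>(\<omega> in M. Y \<omega> = k) > 0 \<Longrightarrow>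
      \<P>(\<omega> in M. Z \<omega> = Suc k \<bar> Y \<omega> = k) = 1 / (1 + real k)"
    and stay: "\<And>k. \<P>(\<omega> in M. Y \<omega> = k) > 0 \<Longrightarrow>
      \<P>(\<omega> in M. Z \<omega> = k \<bar> Y \<omega> = k) = real k / (1 + real k)"
begin

lemma joint_up: "\<P>(\<omega> in M. Z \<omega> = Suc k \<and> Y \<omega> = k) = 1 / (1 + real k) * \<P>(\<omega> in M. Y \<omega> = k)"
  by (rule prob_conj_eq_cond_prob_mult) (measurable, rule up)

lemma joint_stay: "\<P>(\<omega> in M. Z \<omega> = k \<and> Y \<omega> = k) = real k / (1 + real k) * \<P>(\<omega> in M. Y \<omega> = k)"
  by (rule prob_conj_eq_cond_prob_mult) (measurable, rule stay)

lemma AE_step: "AE \<omega> in M. Z \<omega> = Y \<omega> \<or> Z \<omega> = Suc (Y \<omega>)"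
proof -
  have "AE \<omega> in M. \<not> (Y \<omega> = k \<and> Z \<omega> \<noteq> k \<and> Z \<omega> \<noteq> Suc k)" for k
  proof -
    let ?U = "{\<omega> \<in> space M. Z \<omega> = Suc k \<and> Y \<omega> = k}"
    let ?S = "{\<omega> \<in> space M. Z \<omega> = k \<and> Y \<omega> = k}"
    let ?R = "{\<omega> \<in> space M. Y \<omega> = k \<and> Z \<omega> \<noteq> k \<and> Z \<omega> \<noteq> Suc k}"
    have "prob {\<omega> \<in> space M. Y \<omega> = k} = prob (?U \<union> ?S \<union> ?R)"
      by (rule arg_cong[where f = prob]) auto
    also have "\<dots> = prob (?U \<union> ?S) + prob ?R"
      by (rule finite_measure_Union) auto
    also have "prob (?U \<union> ?S) = prob ?U + prob ?S"
      by (rule finite_measure_Union) auto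
    also have "\<dots> = prob {\<omega> \<in> space M. Y \<omega> = k}"
      unfolding joint_up joint_stay distrib_right[symmetric] add_divide_distrib[symmetric] by simp
    finally have "prob ?R = 0" by simp
    then show ?thesis
      by (subst (asm) prob_eq_0) auto
  qed
  \<comment> \<open>There are only countably many states \<open>k\<close>, so the exceptional null
    sets can be combined.\<close>
  then have "AE \<omega> in M. \<forall>k. \<not> (Y \<omega> = k \<and> Z \<omega> \<noteq> k \<and> Z \<omega> \<noteq> Suc k)"
    unfolding AE_all_countable by blast
  then show ?thesis by eventually_elim auto
qed

lemma prob_0: "\<P>(\<omega> in M. Z \<omega> = 0) = 0"
proof -
  \<comment> \<open>Almost surely 0 can only be reached from 0, and state 0 is left with probability
    1.\<close>
  have "\<P>(\<omega> in M. Z \<omega> = 0) = \<P>(\<omega> in M. Z \<omega> = 0 \<and> Y \<omega> = 0)"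
    using AE_step by (intro prob_eq_AE) auto
  then show ?thesis using joint_stay[of 0] by simp
qed

lemma prob_Suc:
  "\<P>(\<omega> in M. Z \<omega> = Suc k) =
     real (Suc k) / (real (Suc k) + 1) * \<P>(\<omega> in M. Y \<omega> = Suc k) +
     1 / real (Suc k) * \<P>(\<omega> in M. Y \<omega> = k)"
proof -
  have "\<P>(\<omega> in M. Z \<omega> = Suc k) =
      \<P>(\<omega> in M. (Z \<omega> = Suc k \<and> Y \<omega> = Suc k) \<or> (Z \<omega> = Suc k \<and> Y \<omega> = k))"
    using AE_step by (intro prob_eq_AE) auto
  also have "\<dots> = prob ({\<omega> \<in> space M. Z \<omega> = Suc k \<and> Y \<omega> = Suc k} \<union>
      {\<omega> \<in> space M. Z \<omega> = Suc k \<and> Y \<omega> = k})"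
    by (rule arg_cong[where f = prob]) auto
  also have "\<dots> = \<P>(\<omega> in M. Z \<omega> = Suc k \<and> Y \<omega> = Suc k) + \<P>(\<omega> in M. Z \<omega> = Suc k \<and> Y \<omega> = k)"
    by (rule finite_measure_Union) auto
  finally show ?thesis
    unfolding joint_up joint_stay by (simp add: add_ac)
qed

end

theorem theorem2:
  fixes M :: "'a measure"
    and X :: "nat \<Rightarrow> 'a \<Rightarrow> nat"
    and p :: "nat \<Rightarrow> nat \<Rightarrow> real"
  assumes chain: "markov_chain M X"
    and start: "AE \<omega> in M. X 0 \<omega> = 0"
    and up: "\<And>n k. \<P>(\<omega> in M. X n \<omega> = k) > 0 \<Longrightarrow>
        \<P>(\<omega> in M. X (n + 1) \<omega> = k + 1 \<bar> X n \<omega> = k) = 1 / (1 + real k)"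
    and stay: "\<And>n k. \<P>(\<omega> in M. X n \<omega> = k) > 0 \<Longrightarrow>
        1 / (1 + real k) = 1 - \<P>(\<omega> in M. X (n + 1) \<omega> = k \<bar> X n \<omega> = k)"
    and p: "\<And>n k. p n k = \<P>(\<omega> in M. X n \<omega> = k)"
  shows "(\<forall>n k. 1 \<le> k \<and> k \<le> n + 1 \<longrightarrow>
            p (n + 1) k = real k / (real k + 1) * p n k + 1 / real k * p n (k - 1)) \<and>
         (\<forall>i j. j \<ge> i + 1 \<longrightarrow> p i j = 0) \<and>
         p 0 0 = 1 \<and>
         (\<forall>n\<ge>1. p n 0 = 0) \<and>
         (\<forall>n k. n \<ge> k \<and> k \<ge> 1 \<longrightarrow>
            p n k = 1 / fact k *
              (\<Sum>i=1..k. (-1) ^ (k - i) * real ((k + 1) choose (i + 1)) * real i ^ k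
                         * (real i / (real i + 1)) ^ (n - k)))"
proof -
  interpret prob_space M
    using chain by (simp add: markov_chain_def)
  have meas [measurable]: "X n \<in> measurable M (count_space UNIV)" for n
    using chain by (simp add: markov_chain_def)
  have step: "birth_step M (X n) (X (Suc n))" for n
  proof
    fix k
    assume pos: "\<P>(\<omega> in M. X n \<omega> = k) > 0"
    show "\<P>(\<omega> in M. X (Suc n) \<omega> = Suc k \<bar> X n \<omega> = k) = 1 / (1 + real k)"
      using up[OF pos] by simp
    have "\<P>(\<omega> in M. X (Suc n) \<omega> = k \<bar> X n \<omega> = k) = 1 - 1 / (1 + real k)"
      using stay[OF pos] by simp
    then show "\<P>(\<omega> in M. X (Suc n) \<omega> = k \<bar> X n \<omega> = k) = real k / (1 + real k)"
      by (simp add: field_simps)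
  qed measurable
  have rec: "p (Suc n) (Suc k) =
      real (Suc k) / (real (Suc k) + 1) * p n (Suc k) + 1 / real (Suc k) * p n k" for n k
    unfolding p by (rule birth_step.prob_Suc[OF step])
  \<comment> \<open>\<open>prob_0\<close> speaks about the state after a transition, hence the step
    from \<open>n - 1\<close>.\<close>
  have p0: "p n 0 = 0" if "n \<ge> 1" for n
    using birth_step.prob_0[OF step[of "n - 1"]] that by (simp add: p)
  have p00: "p 0 0 = 1"
    using start unfolding p by (subst prob_Collect_eq_1) auto
  have above: "p n k = 0" if "n < k" for n k
    using that
  proof (induction n arbitrary: k)
    case 0
    have "AE \<omega> in M. X 0 \<omega> \<noteq> k"
      using start 0 by auto
    then show ?case
      unfolding p by (subst prob_Collect_eq_0) auto
  next
    case (Suc n)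
    then obtain k' where "k = Suc k'" by (cases k) auto
    \<comment> \<open>From \<open>Suc n < Suc k'\<close> follows \<open>n < k'\<close>, so both
      terms of the recurrence vanish by induction.\<close>
    then show ?case using Suc rec[of n k'] by simp
  qed
  have recurrence: "p (n + 1) k = real k / (real k + 1) * p n k + 1 / real k * p n (k - 1)"
    if "1 \<le> k" for n k
    using rec[of n "k - 1"] that by simp
  have closed: "p n k = birth_closed_form n k" if "n \<ge> k" "k \<ge> 1" for n k
    using rec above p00 p0 that by (rule birth_recurrence_unique)
  show ?thesis
    using recurrence above p00 p0 closed[unfolded birth_closed_form_def]
    unfolding Suc_eq_plus1[symmetric] Suc_le_eq by blast
qed

end
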